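(* Let $G$ be a $2$-connected graph. Then for every pair of vertices $u,v$ of $G$, the $uv$ path graph $\mathcal{P}(G_{uv})$ is connected.
   Context: For a path $L$ and vertices $x,y$ on $L$, $L_{xy}$ denotes the subpath of $L$ joining $x$ and $y$. For vertices $u,v$ of a $2$-connected graph $G$, the $uv$ path graph $\mathcal{P}(G_{uv})$ is the graph whose vertices are the paths in $G$ joining $u$ and $v$, where two such paths $S$ and $T$ are adjacent if $T$ is obtained from $S$ by replacing a subpath $S_{xy}$ of $S$ with a subpath $T_{xy}$ of $T$ that is internally disjoint from $S_{xy}$. *)

theory Defs
  imports "Graph_Theory.Graph_Theory"
begin

(* For infinite vertex sets card is 0, hence the guard in the first conjunct. *)
definition k_connected :: "nat \<Rightarrow> ('a, 'b) pre_digraph \<Rightarrow> bool" where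
  "k_connected k G \<longleftrightarrow>
     (finite (verts G) \<longrightarrow> k < card (verts G)) \<and>
     (\<forall>X \<subseteq> verts G. finite X \<and> card X < k \<longrightarrow>
        Digraph_Component.connected (G \<restriction> (verts G - X)))"

(* A path joining u and v is represented by its vertex sequence read from u to v; in a graph
   without parallel edges this sequence and the path determine each other. *)
definition uv_paths :: "('a, 'b) pre_digraph \<Rightarrow> 'a \<Rightarrow> 'a \<Rightarrow> 'a list set" where
  "uv_paths G u v = {p. vpath p G \<and> hd p = u \<and> last p = v}"

(* P is the segment of S joining x and y, and Q is the segment of T joining x and y; outside
   these segments S and T coincide. *)
definition subpath_exchange :: "'a list \<Rightarrow> 'a list \<Rightarrow> bool" where
  "subpath_exchange S T \<longleftrightarrow>
     (\<exists>A P Q B x y. S = A @ P @ B \<and> T = A @ Q @ B \<and>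
        P \<noteq> [] \<and> hd P = x \<and> last P = y \<and>
        Q \<noteq> [] \<and> hd Q = x \<and> last Q = y \<and>
        set P \<inter> set Q = {x, y})"

definition uv_path_graph :: "('a, 'b) pre_digraph \<Rightarrow> 'a \<Rightarrow> 'a \<Rightarrow> 'a list pair_pre_digraph" where
  "uv_path_graph G u v =
     \<lparr> pverts = uv_paths G u v,
       parcs = {(S, T). S \<in> uv_paths G u v \<and> T \<in> uv_paths G u v \<and>
                        S \<noteq> T \<and> subpath_exchange S T} \<rparr>"

lemma subpath_exchange_sym: "subpath_exchange S T \<Longrightarrow> subpath_exchange T S"
  unfolding subpath_exchange_def by (metis Int_commute)

lemma pair_bidirected_digraph_uv_path_graph: "pair_bidirected_digraph (uv_path_graph G u v)"
  by unfold_locales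
    (auto simp: uv_path_graph_def symmetric_def sym_def arcs_ends_def arc_to_ends_def
          intro: subpath_exchange_sym)

end

theory Submission
  imports Defs
begin

text \<open>
  Suppose two \<open>u\<close>-\<open>v\<close> paths \<open>S\<close> and \<open>T\<close> share an initial segment ending in \<open>x\<close>. Let \<open>y\<close> be the first
  vertex of \<open>T\<close> after \<open>x\<close> that lies on \<open>S\<close>; it exists since both paths end in \<open>v\<close>, and it lies on \<open>S\<close>
  after \<open>x\<close>. Replacing the segment of \<open>S\<close> between \<open>x\<close> and \<open>y\<close> by that of \<open>T\<close> is a single exchange, and
  the resulting path shares with \<open>T\<close> a longer initial segment, now ending in \<open>y\<close>. Iterating turns
  \<open>S\<close> into \<open>T\<close>.
\<close>

lemma vwalk_arcs_append_Cons:
  "vwalk_arcs (p @ y # q) = vwalk_arcs (p @ [y]) @ vwalk_arcs (y # q)"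
  by (induction p rule: vwalk_arcs.induct) (cases q; simp)+

text \<open>Each arc of the spliced walk lies on one of the two given paths, since both pass through
  \<open>y\<close>. With both paths repetition-free, only a vertex common to \<open>p'\<close> and
  \<open>q\<close> could be repeated.\<close>

lemma uv_paths_splice:
  assumes "p @ y # q \<in> uv_paths G u v" "p' @ y # q' \<in> uv_paths G u v"
    and "set p' \<inter> set q = {}"
  shows "p' @ y # q \<in> uv_paths G u v"
proof -
  have "hd (p' @ y # q) = hd (p' @ y # q')"
    by (cases p') auto
  with assms show ?thesis
    unfolding uv_paths_def vpath_def vwalk_def
    by (auto simp: vwalk_arcs_append_Cons[of p' y q] vwalk_arcs_append_Cons[of p' y q']
        vwalk_arcs_append_Cons[of p y q])
qed

lemma subpath_exchange_splice:
  assumes "distinct (C @ x # F @ y # H)" "distinct (C @ x # D @ y # E)" "set D \<inter> set F = {}"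
  shows "subpath_exchange (C @ x # F @ y # H) (C @ x # D @ y # H)"
  unfolding subpath_exchange_def
  by (rule exI[of _ C], rule exI[of _ "x # F @ [y]"], rule exI[of _ "x # D @ [y]"],
      rule exI[of _ H]) (use assms in auto)

lemma pverts_uv_path_graph: "pverts (uv_path_graph G u v) = uv_paths G u v"
  by (simp add: uv_path_graph_def)

lemma parcs_uv_path_graph:
  "parcs (uv_path_graph G u v) =
     {(S, T). S \<in> uv_paths G u v \<and> T \<in> uv_paths G u v \<and> S \<noteq> T \<and> subpath_exchange S T}"
  by (simp add: uv_path_graph_def)

lemma uv_path_graph_reachable:
  assumes "C @ x # R \<in> uv_paths G u v" "C @ x # R' \<in> uv_paths G u v"
  shows "(C @ x # R) \<rightarrow>\<^sup>*\<^bsub>with_proj (uv_path_graph G u v)\<^esub> (C @ x # R')"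
  using assms
proof (induction "length R'" arbitrary: C x R R' rule: less_induct)
  case less
  let ?H = "with_proj (uv_path_graph G u v)"
  interpret H: pair_bidirected_digraph "uv_path_graph G u v"
    by (rule pair_bidirected_digraph_uv_path_graph)
  have dist: "distinct (C @ x # R)" "distinct (C @ x # R')"
    and last: "last (x # R) = v" "last (x # R') = v"
    using less.prems by (auto simp: uv_paths_def vpath_def)
  show ?case
  proof (cases "R = [] \<or> R' = []")
    case True
    \<comment> \<open>An empty remainder means \<open>x = v\<close>; a nonempty one would then
      repeat \<open>v\<close>.\<close>
    then have "R = R'"
      using dist last by (auto split: if_splits)
    then show ?thesis
      using less.prems by (simp add: pverts_uv_path_graph)
  next
    case False
    then have "v \<in> set R" "v \<in> set R'"
      using last last_in_set[of R] last_in_set[of R'] by simp_all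
    then obtain D y E where R': "R' = D @ y # E" and "y \<in> set R" and D: "\<forall>d\<in>set D. d \<notin> set R"
      using split_list_first_prop[of R' "\<lambda>z. z \<in> set R"] by blast
    then obtain F K where R: "R = F @ y # K"
      by (meson split_list)
    have "set (C @ x # D) \<inter> set K = {}"
      using dist D by (auto simp: R R')
    then have mem: "C @ x # D @ y # K \<in> uv_paths G u v"
      using uv_paths_splice[of "C @ x # F" y K G u v "C @ x # D" E] less.prems
      by (simp add: R R')
    have "subpath_exchange (C @ x # R) (C @ x # D @ y # K)"
      unfolding R using dist D by (intro subpath_exchange_splice[where E = E]) (auto simp: R R')
    then have "(C @ x # R) \<rightarrow>\<^sup>*\<^bsub>?H\<^esub> (C @ x # D @ y # K)"
      using less.prems(1) mem
      \<comment> \<open>The path graph has no loops, so the case where both paths continue from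
        \<open>x\<close> directly to \<open>y\<close> is separate.\<close>
      by (cases "C @ x # R = C @ x # D @ y # K")
        (simp_all add: pverts_uv_path_graph parcs_uv_path_graph H.reachable_adjI)
    also have "(C @ x # D @ y # K) \<rightarrow>\<^sup>*\<^bsub>?H\<^esub> (C @ x # D @ y # E)"
      \<comment> \<open>The common initial segment now ends in \<open>y\<close>, and
        \<open>E\<close> is shorter than \<open>R'\<close>.\<close>
      using less.hyps[of E "C @ x # D" y K] mem less.prems(2) by (simp add: R')
    finally show ?thesis
      by (simp add: R')
  qed
qed

theorem theorem1:
  fixes G :: "'a pair_pre_digraph"
  assumes "pair_bidirected_digraph G"
    and "k_connected 2 (with_proj G)"
  shows "\<forall>u \<in> pverts G. \<forall>v \<in> pverts G.
           Digraph_Component.connected (with_proj (uv_path_graph (with_proj G) u v))"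
proof (intro ballI)
  fix u v assume uv: "u \<in> pverts G" "v \<in> pverts G"
  interpret G: pair_bidirected_digraph G by fact
  let ?P = "uv_path_graph (with_proj G) u v"
  interpret P: pair_bidirected_digraph ?P
    by (rule pair_bidirected_digraph_uv_path_graph)
  \<comment> \<open>Connectedness of the path graph includes having a vertex. Deleting the empty
    vertex set in \<open>k_connected\<close> shows that \<open>G\<close> is connected, which yields
    a first path from \<open>u\<close> to \<open>v\<close>.\<close>
  have "with_proj G \<restriction> pverts G = with_proj G"
    by (auto simp: induce_subgraph_def with_proj_def intro: G.in_arcsD1 G.in_arcsD2)
  moreover have "Digraph_Component.connected (with_proj G \<restriction> (pverts G - {}))"
    using assms(2) unfolding k_connected_def by force
  ultimately have "strongly_connected (with_proj G)"
    using G.symmetric_connected_imp_strongly_connected G.pair_sym_arcs by simp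
  then have "u \<rightarrow>\<^sup>*\<^bsub>with_proj G\<^esub> v"
    using uv by (auto simp: strongly_connected_def)
  then have nonempty: "uv_paths (with_proj G) u v \<noteq> {}"
    by (auto simp: G.reachable_vpath_conv uv_paths_def)
  have "S \<rightarrow>\<^sup>*\<^bsub>with_proj ?P\<^esub> T"
    if "S \<in> uv_paths (with_proj G) u v" "T \<in> uv_paths (with_proj G) u v" for S T
  proof -
    have "S = [] @ u # tl S" "T = [] @ u # tl T"
      using that by (cases S; cases T; auto simp: uv_paths_def vpath_def vwalk_def)+
    with that show ?thesis
      using uv_path_graph_reachable[of "[]" u "tl S" "with_proj G" u v "tl T"] by simp
  qed
  with nonempty show "Digraph_Component.connected (with_proj ?P)"
    by (intro P.connectedI) (auto simp: pverts_uv_path_graph intro: P.reachable_mk_symmetricI)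
qed

end
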